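(* Let $G=(V,E)$ be a finite connected simple undirected graph, and let $\alpha\ge0$, $\beta,\gamma>0$. Then $G$ satisfies the weighted Eulerianity condition $$\sum_{w'\in\mathrm{ON}(w)}\lambda(w')=\sum_{w'\in\mathrm{IN}(w)}\lambda(w')\qquad\text{for all } w\in W$$ if and only if $G$ is a regular graph. Moreover, let the transition kernel $\hat P$ of the wedge chain $\hat Y$ of the node2vec random walk $X$ on $G$ with parameters $\alpha,\beta,\gamma$ be irreducible, and assume that $G$ satisfies the weighted Eulerianity condition above. Put $Z=\sum_{w'\in W}\lambda(w')$. Then the stationary distributions of $\hat Y$ on $W$ and of $X$ on $V$ are, respectively, $$\hat\pi(w)=\frac{\lambda(w)}{Z}\quad(w\in W),\qquad \pi(v)=\sum_{w\in\mathrm{IN}(v)}\frac{\lambda(w)}{Z}\quad(v\in V).$$ Additionally, $\hat\pi$ satisfies the wedge directed detailed balance $$\hat\pi(w)\hat P(w,w')=\hat\pi(w')\hat P(-w',-w)\qquad\text{for all } w,w'\in W.$$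
   Context: Graphs are simple (no self-loops or multi-edges). $\vec E=\{(v_1,v_2):\{v_1,v_2\}\in E\}$ is the set of directed edges. Node2vec random walk: the process $X=(X_n)_{n\ge0}$ on $V$ such that for $\{s,u\},\{u,v\}\in E$ and $n\ge 1$, $\mathbb P(X_{n+1}=v\mid X_n=u,X_{n-1}=s)$ is proportional (over neighbors $v$ of $u$) to $\alpha$ if $s=v$, to $\beta$ if $\{s,v\}\in E$, and to $\gamma$ if $\{s,v\}\notin E$ and $s\ne v$. Directed wedges: $W=\{w=(w(1),w(2),w(3)): (w(1),w(2))\in\vec E,\ (w(2),w(3))\in\vec E\}$, and $-w=(w(3),w(2),w(1))$. The type $\lambda(w)$ of $w\in W$ is $\alpha$ if $w(1)=w(3)$ (flat wedge), $\beta$ if $\{w(1),w(3)\}\in E$, and $\gamma$ otherwise. For $w\in W$: $\mathrm{IN}(w)=\{w'\in W: w'(2)=w(1),\,w'(3)=w(2)\}$ and $\mathrm{ON}(w)=\{w'\in W: w'(1)=w(1),\,w'(2)=w(2)\}$. For $v\in V$: $\mathrm{IN}(v)=\{w'\in W: w'(3)=v\}$. Set $p(w)=\lambda(w)/\sum_{w'\in\mathrm{ON}(w)}\lambda(w')$ (whenever $\hat P$ is considered, these denominators are assumed positive, i.e. no vertices of degree one if $\alpha=0$). The wedge chain $\hat Y$ is the Markov chain with kernel $\hat P(w,w')=p(w')$ if $w\in\mathrm{IN}(w')$ and $\hat P(w,w')=0$ otherwise. Its state space is $W$ if $\alpha>0$; if $\alpha=0$, flat wedges have $p(w)=0$ and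 can never be entered, and irreducibility and stationarity refer to the non-flat wedges, with $\hat\pi(w)=0$ for flat $w$. The stationary distribution of $X$ on $V$ is the projection $\pi(v)=\sum_{w\in\mathrm{IN}(v)}\hat\pi(w)$ of the stationary distribution $\hat\pi$ of $\hat Y$. *)

theory Defs
  imports Complex_Main
begin

type_synonym 'a wedge = "'a \<times> 'a \<times> 'a"

definition simple_graph :: "'a set \<Rightarrow> 'a set set \<Rightarrow> bool" where
  "simple_graph V E \<longleftrightarrow> (\<forall>e\<in>E. e \<subseteq> V \<and> card e = 2)"

definition dir_edges :: "'a set set \<Rightarrow> ('a \<times> 'a) set" where
  "dir_edges E = {(u, v). {u, v} \<in> E}"

definition connected_graph :: "'a set \<Rightarrow> 'a set set \<Rightarrow> bool" where
  "connected_graph V E \<longleftrightarrow> (\<forall>u\<in>V. \<forall>v\<in>V. (u, v) \<in> (dir_edges E)\<^sup>*)"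

definition neighbors :: "'a set set \<Rightarrow> 'a \<Rightarrow> 'a set" where
  "neighbors E u = {v. {u, v} \<in> E}"

definition regular_graph :: "'a set \<Rightarrow> 'a set set \<Rightarrow> bool" where
  "regular_graph V E \<longleftrightarrow> (\<exists>d. \<forall>v\<in>V. card (neighbors E v) = d)"

definition w1 :: "'a wedge \<Rightarrow> 'a" where "w1 w = fst w"
definition w2 :: "'a wedge \<Rightarrow> 'a" where "w2 w = fst (snd w)"
definition w3 :: "'a wedge \<Rightarrow> 'a" where "w3 w = snd (snd w)"

definition wedges :: "'a set set \<Rightarrow> 'a wedge set" where
  "wedges E = {w. (w1 w, w2 w) \<in> dir_edges E \<and> (w2 w, w3 w) \<in> dir_edges E}"

definition wedge_rev :: "'a wedge \<Rightarrow> 'a wedge" where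
  "wedge_rev w = (w3 w, w2 w, w1 w)"

definition wedge_type :: "'a set set \<Rightarrow> real \<Rightarrow> real \<Rightarrow> real \<Rightarrow> 'a wedge \<Rightarrow> real" where
  "wedge_type E \<alpha> \<beta> \<gamma> w =
     (if w1 w = w3 w then \<alpha> else if {w1 w, w3 w} \<in> E then \<beta> else \<gamma>)"

definition IN_wedge :: "'a set set \<Rightarrow> 'a wedge \<Rightarrow> 'a wedge set" where
  "IN_wedge E w = {w' \<in> wedges E. w2 w' = w1 w \<and> w3 w' = w2 w}"

definition ON_wedge :: "'a set set \<Rightarrow> 'a wedge \<Rightarrow> 'a wedge set" where
  "ON_wedge E w = {w' \<in> wedges E. w1 w' = w1 w \<and> w2 w' = w2 w}"

definition IN_vertex :: "'a set set \<Rightarrow> 'a \<Rightarrow> 'a wedge set" where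
  "IN_vertex E v = {w' \<in> wedges E. w3 w' = v}"

definition weighted_eulerian :: "'a set set \<Rightarrow> real \<Rightarrow> real \<Rightarrow> real \<Rightarrow> bool" where
  "weighted_eulerian E \<alpha> \<beta> \<gamma> \<longleftrightarrow>
     (\<forall>w\<in>wedges E. (\<Sum>w'\<in>ON_wedge E w. wedge_type E \<alpha> \<beta> \<gamma> w')
                  = (\<Sum>w'\<in>IN_wedge E w. wedge_type E \<alpha> \<beta> \<gamma> w'))"

definition wedge_prob :: "'a set set \<Rightarrow> real \<Rightarrow> real \<Rightarrow> real \<Rightarrow> 'a wedge \<Rightarrow> real" where
  "wedge_prob E \<alpha> \<beta> \<gamma> w =
     wedge_type E \<alpha> \<beta> \<gamma> w / (\<Sum>w'\<in>ON_wedge E w. wedge_type E \<alpha> \<beta> \<gamma> w')"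

text \<open>One step of the node2vec walk: the probability of moving to the neighbor \<open>v\<close> of the
  current vertex \<open>u\<close> when the previous vertex was \<open>s\<close>.\<close>

definition node2vec_weight ::
    "'a set set \<Rightarrow> real \<Rightarrow> real \<Rightarrow> real \<Rightarrow> 'a \<Rightarrow> 'a \<Rightarrow> real" where
  "node2vec_weight E \<alpha> \<beta> \<gamma> s v =
     (if s = v then \<alpha> else if {s, v} \<in> E then \<beta> else \<gamma>)"

definition node2vec_step ::
    "'a set set \<Rightarrow> real \<Rightarrow> real \<Rightarrow> real \<Rightarrow> 'a \<Rightarrow> 'a \<Rightarrow> 'a \<Rightarrow> real" where
  "node2vec_step E \<alpha> \<beta> \<gamma> s u v =
     node2vec_weight E \<alpha> \<beta> \<gamma> s v / (\<Sum>x\<in>neighbors E u. node2vec_weight E \<alpha> \<beta> \<gamma> s x)"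

lemma wedge_prob_eq_node2vec_step:
  assumes "{s, u} \<in> E"
  shows "wedge_prob E \<alpha> \<beta> \<gamma> (s, u, v) = node2vec_step E \<alpha> \<beta> \<gamma> s u v"
proof -
  have ON: "ON_wedge E (s, u, v) = (\<lambda>x. (s, u, x)) ` neighbors E u"
    using assms
    by (auto simp: ON_wedge_def wedges_def dir_edges_def neighbors_def w1_def w2_def w3_def)
  have type: "wedge_type E \<alpha> \<beta> \<gamma> (s, u, x) = node2vec_weight E \<alpha> \<beta> \<gamma> s x" for x
    unfolding wedge_type_def node2vec_weight_def w1_def w3_def fst_conv snd_conv by (rule refl)
  have "(\<Sum>w'\<in>ON_wedge E (s, u, v). wedge_type E \<alpha> \<beta> \<gamma> w')
      = (\<Sum>x\<in>neighbors E u. node2vec_weight E \<alpha> \<beta> \<gamma> s x)"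
    unfolding ON by (subst sum.reindex) (simp_all add: inj_on_def type)
  then show ?thesis
    by (simp add: wedge_prob_def node2vec_step_def type)
qed

definition wedge_kernel ::
    "'a set set \<Rightarrow> real \<Rightarrow> real \<Rightarrow> real \<Rightarrow> 'a wedge \<Rightarrow> 'a wedge \<Rightarrow> real" where
  "wedge_kernel E \<alpha> \<beta> \<gamma> w w' = (if w \<in> IN_wedge E w' then wedge_prob E \<alpha> \<beta> \<gamma> w' else 0)"

text \<open>If \<open>\<alpha> = 0\<close>, the flat wedges can never be entered and are not states of the chain.\<close>

definition wedge_states :: "'a set set \<Rightarrow> real \<Rightarrow> 'a wedge set" where
  "wedge_states E \<alpha> = (if \<alpha> = 0 then {w \<in> wedges E. w1 w \<noteq> w3 w} else wedges E)"

primrec kernel_power :: "'s set \<Rightarrow> ('s \<Rightarrow> 's \<Rightarrow> real) \<Rightarrow> nat \<Rightarrow> 's \<Rightarrow> 's \<Rightarrow> real" where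
  "kernel_power S K 0 x y = (if x = y then 1 else 0)"
| "kernel_power S K (Suc n) x y = (\<Sum>z\<in>S. K x z * kernel_power S K n z y)"

text \<open>A Markov chain lives on a nonempty state space, so the nonemptiness is part of
  irreducibility; it excludes the edgeless graph, which has no wedges.\<close>

definition irreducible_kernel :: "'s set \<Rightarrow> ('s \<Rightarrow> 's \<Rightarrow> real) \<Rightarrow> bool" where
  "irreducible_kernel S K \<longleftrightarrow>
     S \<noteq> {} \<and> (\<forall>x\<in>S. \<forall>y\<in>S. \<exists>n. kernel_power S K n x y > 0)"

definition stationary_distribution :: "'s set \<Rightarrow> ('s \<Rightarrow> 's \<Rightarrow> real) \<Rightarrow> ('s \<Rightarrow> real) \<Rightarrow> bool" where
  "stationary_distribution S K \<mu> \<longleftrightarrow>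
     (\<forall>x\<in>S. 0 \<le> \<mu> x) \<and> (\<Sum>x\<in>S. \<mu> x) = 1 \<and> (\<forall>y\<in>S. (\<Sum>x\<in>S. \<mu> x * K x y) = \<mu> y)"

text \<open>Stationary distributions of the wedge chain, extended by zero from the states to all
  wedges. Values outside the set of wedges are irrelevant.\<close>

definition wedge_stationary ::
    "'a set set \<Rightarrow> real \<Rightarrow> real \<Rightarrow> real \<Rightarrow> ('a wedge \<Rightarrow> real) \<Rightarrow> bool" where
  "wedge_stationary E \<alpha> \<beta> \<gamma> \<mu> \<longleftrightarrow>
     stationary_distribution (wedge_states E \<alpha>) (wedge_kernel E \<alpha> \<beta> \<gamma>) \<mu> \<and>
     (\<forall>w \<in> wedges E - wedge_states E \<alpha>. \<mu> w = 0)"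

text \<open>The node2vec walk is not a Markov chain on the vertices; its stationary distributions
  are by definition the projections of those of the wedge chain.\<close>

definition node2vec_stationary ::
    "'a set \<Rightarrow> 'a set set \<Rightarrow> real \<Rightarrow> real \<Rightarrow> real \<Rightarrow> ('a \<Rightarrow> real) \<Rightarrow> bool" where
  "node2vec_stationary V E \<alpha> \<beta> \<gamma> \<pi> \<longleftrightarrow>
     (\<exists>\<mu>. wedge_stationary E \<alpha> \<beta> \<gamma> \<mu> \<and> (\<forall>v\<in>V. \<pi> v = (\<Sum>w\<in>IN_vertex E v. \<mu> w)))"

definition wedge_directed_detailed_balance ::
    "'a set set \<Rightarrow> real \<Rightarrow> real \<Rightarrow> real \<Rightarrow> ('a wedge \<Rightarrow> real) \<Rightarrow> bool" where
  "wedge_directed_detailed_balance E \<alpha> \<beta> \<gamma> \<mu> \<longleftrightarrow>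
     (\<forall>w\<in>wedges E. \<forall>w'\<in>wedges E.
        \<mu> w * wedge_kernel E \<alpha> \<beta> \<gamma> w w'
        = \<mu> w' * wedge_kernel E \<alpha> \<beta> \<gamma> (wedge_rev w') (wedge_rev w))"

end

theory Submission
  imports Defs
begin

text \<open>
  Both sums of the Eulerianity condition depend only on the directed edge \<open>(s, u)\<close> with which
  the wedge starts. Reversing wedges keeps their type, so the incoming sum of \<open>(s, u)\<close> is the
  outgoing sum of \<open>(u, s)\<close>. The outgoing sum runs over the neighbours of \<open>u\<close>: one of them
  (\<open>s\<close> itself) has weight \<open>\<alpha>\<close>, the common neighbours of \<open>s\<close> and \<open>u\<close> have weight \<open>\<beta>\<close>,
  and all others have weight \<open>\<gamma>\<close>. The number of common neighbours is symmetric in \<open>s\<close> and \<open>u\<close>,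
  hence the two sums differ by \<open>\<gamma> * (deg u - deg s)\<close> (lemma \<open>out_weight_diff\<close>). As
  \<open>\<gamma> > 0\<close>, the condition says that adjacent vertices have equal degrees, which in a connected
  graph is regularity.

  Under the condition, the weight flowing through a wedge \<open>y\<close> is
  \<open>(\<Sum>x\<in>IN y. \<lambda> x) * \<lambda> y / (\<Sum>x\<in>ON y. \<lambda> x) = \<lambda> y\<close>, so \<open>\<lambda> / Z\<close> is stationary. It is the
  only stationary distribution because an irreducible finite kernel has at most one
  (lemma \<open>stationary_distribution_unique\<close>): subtracting from one of two stationary distributions
  the largest multiple of the other that keeps it nonnegative leaves an invariant function
  with a zero, and by irreducibility such a function vanishes. So the two are proportional,
  and equal because both have total mass one.

  Both sides of the detailed balance vanish unless \<open>w\<close> leads into \<open>w'\<close>. Otherwise they are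
  \<open>\<lambda> w * \<lambda> w'\<close> divided by \<open>Z\<close> and by an outgoing sum. The edges concerned, the common edge
  of \<open>w\<close> and \<open>w'\<close> and its reversal, have equal outgoing sums by Eulerianity.
\<close>

section \<open>Uniqueness of stationary distributions of irreducible kernels\<close>

lemma kernel_power_nonneg:
  assumes "\<forall>x\<in>S. \<forall>y\<in>S. K x y \<ge> 0" and "x \<in> S" and "y \<in> S"
  shows "kernel_power S K n x y \<ge> 0"
  using assms(2)
  by (induction n arbitrary: x) (auto intro!: sum_nonneg mult_nonneg_nonneg simp: assms)

lemma invariant_kernel_power:
  assumes "finite S" and inv: "\<forall>y\<in>S. (\<Sum>x\<in>S. f x * K x y) = f y" and "y \<in> S"
  shows "(\<Sum>x\<in>S. f x * kernel_power S K n x y) = f y"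
proof (induction n)
  case 0
  have "(\<Sum>x\<in>S. f x * kernel_power S K 0 x y) = (\<Sum>x\<in>S. if x = y then f x else 0)"
    by (rule sum.cong) auto
  then show ?case
    using assms by simp
next
  case (Suc n)
  have "(\<Sum>x\<in>S. f x * kernel_power S K (Suc n) x y)
      = (\<Sum>x\<in>S. \<Sum>z\<in>S. f x * K x z * kernel_power S K n z y)"
    by (simp add: sum_distrib_left mult.assoc)
  also have "\<dots> = (\<Sum>z\<in>S. (\<Sum>x\<in>S. f x * K x z) * kernel_power S K n z y)"
    by (subst sum.swap) (simp add: sum_distrib_right)
  also have "\<dots> = (\<Sum>z\<in>S. f z * kernel_power S K n z y)"
    using inv by simp
  finally show ?case
    using Suc.IH by simp
qed

text \<open>The value at the zero is a sum of nonnegative terms for every power of the kernel, and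
  every state \<open>x\<close> occurs with a positive coefficient in the sum for some power.\<close>

lemma irreducible_invariant_zero:
  assumes "finite S" and nonneg: "\<forall>x\<in>S. \<forall>y\<in>S. K x y \<ge> 0" and irr: "irreducible_kernel S K"
    and f: "\<forall>x\<in>S. f x \<ge> 0" and inv: "\<forall>y\<in>S. (\<Sum>x\<in>S. f x * K x y) = f y"
    and y: "y \<in> S" "f y = 0" and x: "x \<in> S"
  shows "f x = 0"
proof -
  obtain n where n: "kernel_power S K n x y > 0"
    using irr x y unfolding irreducible_kernel_def by blast
  have "(\<Sum>x\<in>S. f x * kernel_power S K n x y) = 0"
    using invariant_kernel_power[OF \<open>finite S\<close> inv y(1)] y(2) by simp
  moreover have "\<forall>x\<in>S. f x * kernel_power S K n x y \<ge> 0"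
    using f kernel_power_nonneg[OF nonneg _ y(1)] by simp
  ultimately have "f x * kernel_power S K n x y = 0"
    using \<open>finite S\<close> x by (simp add: sum_nonneg_eq_0_iff)
  then show ?thesis
    using n by simp
qed

lemma irreducible_stationary_pos:
  assumes "finite S" and "\<forall>x\<in>S. \<forall>y\<in>S. K x y \<ge> 0" and "irreducible_kernel S K"
    and st: "stationary_distribution S K \<mu>" and "x \<in> S"
  shows "\<mu> x > 0"
proof (rule ccontr)
  assume "\<not> \<mu> x > 0"
  then have "\<mu> x = 0"
    using st \<open>x \<in> S\<close> unfolding stationary_distribution_def by force
  then have "\<forall>y\<in>S. \<mu> y = 0"
    using irreducible_invariant_zero[OF assms(1-3), of \<mu> x] st \<open>x \<in> S\<close>
    unfolding stationary_distribution_def by blast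
  then show False
    using st unfolding stationary_distribution_def by simp
qed

lemma stationary_distribution_unique:
  assumes fin: "finite S" and nonneg: "\<forall>x\<in>S. \<forall>y\<in>S. K x y \<ge> 0"
    and irr: "irreducible_kernel S K"
    and \<mu>: "stationary_distribution S K \<mu>" and \<nu>: "stationary_distribution S K \<nu>"
    and "x \<in> S"
  shows "\<mu> x = \<nu> x"
proof -
  have pos: "\<nu> y > 0" if "y \<in> S" for y
    using irreducible_stationary_pos[OF fin nonneg irr \<nu> that] .
  \<comment> \<open>The largest multiple of \<open>\<nu>\<close> below \<open>\<mu>\<close>.\<close>
  define m where "m = Min ((\<lambda>y. \<mu> y / \<nu> y) ` S)"
  have "m \<in> (\<lambda>y. \<mu> y / \<nu> y) ` S"
    unfolding m_def using fin \<open>x \<in> S\<close> by (intro Min_in) auto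
  then obtain z where z: "z \<in> S" "m = \<mu> z / \<nu> z"
    by blast
  define f where "f y = \<mu> y - m * \<nu> y" for y
  have "f y \<ge> 0" if "y \<in> S" for y
  proof -
    have "m \<le> \<mu> y / \<nu> y"
      unfolding m_def using fin that by simp
    then show ?thesis
      using pos[OF that] by (simp add: f_def pos_le_divide_eq)
  qed
  moreover have "(\<Sum>y\<in>S. f y * K y y') = f y'" if "y' \<in> S" for y'
  proof -
    have "(\<Sum>y\<in>S. f y * K y y') = (\<Sum>y\<in>S. \<mu> y * K y y') - m * (\<Sum>y\<in>S. \<nu> y * K y y')"
      by (simp add: f_def left_diff_distrib sum_subtractf sum_distrib_left mult.assoc)
    then show ?thesis
      using \<mu> \<nu> that by (simp add: stationary_distribution_def f_def)
  qed
  moreover have "f z = 0"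
    using z pos[OF z(1)] by (simp add: f_def)
  ultimately have zero: "f y = 0" if "y \<in> S" for y
    using irreducible_invariant_zero[OF fin nonneg irr, of f z] z(1) that by blast
  have "(\<Sum>y\<in>S. f y) = 1 - m"
    using \<mu> \<nu> by (simp add: f_def sum_subtractf stationary_distribution_def
        flip: sum_distrib_left)
  then have "m = 1"
    using zero by simp
  then show ?thesis
    using zero[OF \<open>x \<in> S\<close>] by (simp add: f_def)
qed

section \<open>Weights of directed edges\<close>

text \<open>The normalizing constant of the node2vec step from \<open>u\<close> with previous vertex \<open>s\<close>.\<close>

definition out_weight :: "'a set set \<Rightarrow> real \<Rightarrow> real \<Rightarrow> real \<Rightarrow> 'a \<Rightarrow> 'a \<Rightarrow> real" where
  "out_weight E \<alpha> \<beta> \<gamma> s u = (\<Sum>x\<in>neighbors E u. node2vec_weight E \<alpha> \<beta> \<gamma> s x)"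

lemma wedge_type_eq_node2vec_weight:
  "wedge_type E \<alpha> \<beta> \<gamma> (s, u, x) = node2vec_weight E \<alpha> \<beta> \<gamma> s x"
  by (simp only: wedge_type_def node2vec_weight_def w1_def w3_def fst_conv snd_conv)

lemma wedge_rev_coord:
  "w1 (wedge_rev w) = w3 w" "w2 (wedge_rev w) = w2 w" "w3 (wedge_rev w) = w1 w"
  by (simp_all add: wedge_rev_def w1_def w2_def w3_def)

lemma wedge_type_rev: "wedge_type E \<alpha> \<beta> \<gamma> (wedge_rev w) = wedge_type E \<alpha> \<beta> \<gamma> w"
  by (auto simp: wedge_type_def wedge_rev_def w1_def w3_def insert_commute)

lemma sum_ON_wedge:
  assumes "w \<in> wedges E"
  shows "(\<Sum>w'\<in>ON_wedge E w. wedge_type E \<alpha> \<beta> \<gamma> w') = out_weight E \<alpha> \<beta> \<gamma> (w1 w) (w2 w)"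
proof -
  have "ON_wedge E w = (\<lambda>x. (w1 w, w2 w, x)) ` neighbors E (w2 w)"
    using assms
    by (auto simp: ON_wedge_def wedges_def dir_edges_def neighbors_def w1_def w2_def w3_def)
  then show ?thesis
    by (simp add: sum.reindex inj_on_def out_weight_def wedge_type_eq_node2vec_weight)
qed

text \<open>The wedges that lead into an edge are the reversals of those that leave the reversed
  edge, and reversal keeps the type.\<close>

lemma sum_IN_wedge:
  assumes "w \<in> wedges E"
  shows "(\<Sum>w'\<in>IN_wedge E w. wedge_type E \<alpha> \<beta> \<gamma> w') = out_weight E \<alpha> \<beta> \<gamma> (w2 w) (w1 w)"
proof -
  have "IN_wedge E w = (\<lambda>x. wedge_rev (w2 w, w1 w, x)) ` neighbors E (w1 w)"
    using assms
    by (auto simp: IN_wedge_def wedges_def dir_edges_def neighbors_def wedge_rev_def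
        w1_def w2_def w3_def insert_commute)
  moreover have "inj_on (\<lambda>x. wedge_rev (w2 w, w1 w, x)) (neighbors E (w1 w))"
    by (simp add: inj_on_def wedge_rev_def w3_def w2_def w1_def)
  ultimately show ?thesis
    by (simp add: sum.reindex out_weight_def wedge_type_rev wedge_type_eq_node2vec_weight)
qed

lemma wedge_edge: "w \<in> wedges E \<Longrightarrow> {w1 w, w2 w} \<in> E"
  by (simp add: wedges_def dir_edges_def)

text \<open>Every edge starts a wedge, namely the flat one, so a condition on the initial edges of all
  wedges is a condition on all edges.\<close>

lemma weighted_eulerian_iff_out_weight_sym:
  "weighted_eulerian E \<alpha> \<beta> \<gamma> \<longleftrightarrow>
    (\<forall>s u. {s, u} \<in> E \<longrightarrow> out_weight E \<alpha> \<beta> \<gamma> s u = out_weight E \<alpha> \<beta> \<gamma> u s)"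
proof
  assume eul: "weighted_eulerian E \<alpha> \<beta> \<gamma>"
  show "\<forall>s u. {s, u} \<in> E \<longrightarrow> out_weight E \<alpha> \<beta> \<gamma> s u = out_weight E \<alpha> \<beta> \<gamma> u s"
  proof (intro allI impI)
    fix s u assume "{s, u} \<in> E"
    then have "(s, u, s) \<in> wedges E"
      by (simp add: wedges_def dir_edges_def w1_def w2_def w3_def insert_commute)
    moreover have "w1 (s, u, s) = s" "w2 (s, u, s) = u"
      by (simp_all add: w1_def w2_def)
    ultimately show "out_weight E \<alpha> \<beta> \<gamma> s u = out_weight E \<alpha> \<beta> \<gamma> u s"
      using eul unfolding weighted_eulerian_def by (metis sum_ON_wedge sum_IN_wedge)
  qed
next
  assume "\<forall>s u. {s, u} \<in> E \<longrightarrow> out_weight E \<alpha> \<beta> \<gamma> s u = out_weight E \<alpha> \<beta> \<gamma> u s"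
  then show "weighted_eulerian E \<alpha> \<beta> \<gamma>"
    unfolding weighted_eulerian_def
    by (metis (no_types, lifting) sum_ON_wedge sum_IN_wedge wedge_edge)
qed

section \<open>Eulerianity and regularity\<close>

lemma finite_neighbors:
  assumes "finite V" and "simple_graph V E"
  shows "finite (neighbors E u)"
proof (rule finite_subset)
  show "neighbors E u \<subseteq> V"
    using assms(2) by (auto simp: neighbors_def simple_graph_def)
qed fact

lemma simple_graph_no_loop: "simple_graph V E \<Longrightarrow> {u, u} \<notin> E"
  by (auto simp: simple_graph_def)

lemma out_weight_eq:
  assumes "finite V" and simple: "simple_graph V E" and edge: "{s, u} \<in> E"
  shows "out_weight E \<alpha> \<beta> \<gamma> s u = \<gamma> * card (neighbors E u) + (\<alpha> - \<gamma>)
    + (\<beta> - \<gamma>) * card (neighbors E u \<inter> neighbors E s)"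
proof -
  let ?N = "neighbors E u"
  have fin: "finite ?N"
    using finite_neighbors[OF assms(1,2)] .
  have s: "s \<in> ?N"
    using edge by (simp add: neighbors_def insert_commute)
  \<comment> \<open>The two corrections never apply to the same \<open>x\<close>, as \<open>s\<close> is not its own neighbour.\<close>
  have "s \<notin> neighbors E s"
    using simple_graph_no_loop[OF simple] by (simp only: neighbors_def mem_Collect_eq) simp
  then have "node2vec_weight E \<alpha> \<beta> \<gamma> s x = \<gamma> + (if x = s then \<alpha> - \<gamma> else 0)
      + (if x \<in> neighbors E s then \<beta> - \<gamma> else 0)" for x
    by (cases "x = s") (simp_all add: node2vec_weight_def neighbors_def)
  then have "out_weight E \<alpha> \<beta> \<gamma> s u = (\<Sum>x\<in>?N. \<gamma>) + (\<Sum>x\<in>?N. if x = s then \<alpha> - \<gamma> else 0)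
      + (\<Sum>x\<in>?N. if x \<in> neighbors E s then \<beta> - \<gamma> else 0)"
    by (simp add: out_weight_def sum.distrib)
  also have "(\<Sum>x\<in>?N. if x \<in> neighbors E s then \<beta> - \<gamma> else 0)
      = (\<beta> - \<gamma>) * card (?N \<inter> neighbors E s)"
    using fin by (simp flip: sum.inter_restrict)
  finally show ?thesis
    using fin s by simp
qed

lemma out_weight_diff:
  assumes "finite V" and "simple_graph V E" and "{s, u} \<in> E"
  shows "out_weight E \<alpha> \<beta> \<gamma> s u - out_weight E \<alpha> \<beta> \<gamma> u s
    = \<gamma> * (real (card (neighbors E u)) - real (card (neighbors E s)))"
proof -
  have "{u, s} \<in> E"
    using assms(3) by (simp add: insert_commute)
  then show ?thesis
    using out_weight_eq[OF assms(1,2,3)] out_weight_eq[OF assms(1,2), of u s]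
    by (simp add: Int_commute right_diff_distrib)
qed

lemma regular_graph_iff_adjacent:
  assumes "simple_graph V E" and conn: "connected_graph V E"
  shows "regular_graph V E \<longleftrightarrow>
    (\<forall>s u. {s, u} \<in> E \<longrightarrow> card (neighbors E s) = card (neighbors E u))"
    (is "_ \<longleftrightarrow> ?adj")
proof
  assume "regular_graph V E"
  then obtain d where d: "\<forall>v\<in>V. card (neighbors E v) = d"
    unfolding regular_graph_def by blast
  have "s \<in> V \<and> u \<in> V" if "{s, u} \<in> E" for s u
    using assms(1) that by (auto simp: simple_graph_def)
  then show ?adj
    using d by simp
next
  assume adj: ?adj
  have "card (neighbors E u) = card (neighbors E v)" if "(u, v) \<in> (dir_edges E)\<^sup>*" for u v
    using that
  proof (induction rule: rtrancl_induct)
    case (step v w)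
    then have "card (neighbors E v) = card (neighbors E w)"
      using adj unfolding dir_edges_def by blast
    then show ?case
      using step.IH by simp
  qed simp
  then have "\<forall>u\<in>V. \<forall>v\<in>V. card (neighbors E u) = card (neighbors E v)"
    using conn unfolding connected_graph_def by blast
  then show "regular_graph V E"
    unfolding regular_graph_def by blast
qed

lemma weighted_eulerian_iff_regular:
  assumes "finite V" and "simple_graph V E" and "connected_graph V E" and "\<gamma> > 0"
  shows "weighted_eulerian E \<alpha> \<beta> \<gamma> \<longleftrightarrow> regular_graph V E"
proof -
  have "out_weight E \<alpha> \<beta> \<gamma> s u = out_weight E \<alpha> \<beta> \<gamma> u s \<longleftrightarrow>
      card (neighbors E s) = card (neighbors E u)" if "{s, u} \<in> E" for s u
    using out_weight_diff[OF assms(1,2) that, of \<alpha> \<beta> \<gamma>] \<open>\<gamma> > 0\<close> by auto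
  then show ?thesis
    unfolding weighted_eulerian_iff_out_weight_sym regular_graph_iff_adjacent[OF assms(2,3)]
    by simp
qed

section \<open>The stationary distribution of the wedge chain\<close>

lemma finite_wedges:
  assumes "finite V" and "simple_graph V E"
  shows "finite (wedges E)"
proof (rule finite_subset)
  have "u \<in> V \<and> v \<in> V" if "{u, v} \<in> E" for u v
    using assms(2) that by (auto simp: simple_graph_def)
  then show "wedges E \<subseteq> V \<times> V \<times> V"
    by (auto simp: wedges_def dir_edges_def w1_def w2_def w3_def)
qed (use assms(1) in simp)

lemma wedge_type_nonneg:
  assumes "\<alpha> \<ge> 0" and "\<beta> > 0" and "\<gamma> > 0"
  shows "wedge_type E \<alpha> \<beta> \<gamma> w \<ge> 0"
  using assms by (simp add: wedge_type_def)

lemma wedge_type_pos: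
  assumes "\<alpha> \<ge> 0" and "\<beta> > 0" and "\<gamma> > 0" and "w \<in> wedge_states E \<alpha>"
  shows "wedge_type E \<alpha> \<beta> \<gamma> w > 0"
  using assms by (auto simp: wedge_type_def wedge_states_def split: if_splits)

lemma wedge_type_nonstate:
  "w \<in> wedges E - wedge_states E \<alpha> \<Longrightarrow> wedge_type E \<alpha> \<beta> \<gamma> w = 0"
  by (auto simp: wedge_type_def wedge_states_def split: if_splits)

lemma wedge_states_subset: "wedge_states E \<alpha> \<subseteq> wedges E"
  by (auto simp: wedge_states_def)

lemma wedge_kernel_nonneg:
  assumes "\<alpha> \<ge> 0" and "\<beta> > 0" and "\<gamma> > 0"
  shows "wedge_kernel E \<alpha> \<beta> \<gamma> w w' \<ge> 0"
  using wedge_type_nonneg[OF assms, of E]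
  by (simp add: wedge_kernel_def wedge_prob_def sum_nonneg)

lemma wedge_stationary_type:
  assumes fin: "finite (wedges E)" and par: "\<alpha> \<ge> 0" "\<beta> > 0" "\<gamma> > 0"
    and ON_pos: "\<forall>w\<in>wedges E. (\<Sum>w'\<in>ON_wedge E w. wedge_type E \<alpha> \<beta> \<gamma> w') > 0"
    and states: "wedge_states E \<alpha> \<noteq> {}"
    and eul: "weighted_eulerian E \<alpha> \<beta> \<gamma>"
  shows "wedge_stationary E \<alpha> \<beta> \<gamma>
    (\<lambda>w. wedge_type E \<alpha> \<beta> \<gamma> w / (\<Sum>w'\<in>wedges E. wedge_type E \<alpha> \<beta> \<gamma> w'))"
proof -
  let ?S = "wedge_states E \<alpha>" and ?l = "wedge_type E \<alpha> \<beta> \<gamma>" and ?K = "wedge_kernel E \<alpha> \<beta> \<gamma>"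
  define Z where "Z = (\<Sum>w'\<in>wedges E. ?l w')"
  \<comment> \<open>For \<open>\<alpha> = 0\<close> the flat wedges are no states, but their weight is zero, so that sums of
    weights over the states agree with sums over all wedges, whatever \<open>\<alpha>\<close> is.\<close>
  have to_wedges: "(\<Sum>x\<in>?S. ?l x * g x) = (\<Sum>x\<in>wedges E. ?l x * g x)" for g
    using fin wedge_states_subset wedge_type_nonstate
    by (intro sum.mono_neutral_left) fastforce+
  have Z_states: "(\<Sum>x\<in>?S. ?l x) = Z"
    using to_wedges[of "\<lambda>_. 1"] by (simp add: Z_def)
  have "(\<Sum>x\<in>?S. ?l x) > 0"
    using finite_subset[OF wedge_states_subset fin] states wedge_type_pos[OF par]
    by (intro sum_pos)
  then have "Z > 0"
    using Z_states by simp
  have inv: "(\<Sum>x\<in>?S. ?l x / Z * ?K x y) = ?l y / Z" if y: "y \<in> wedges E" for y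
  proof -
    have IN: "{x \<in> wedges E. x \<in> IN_wedge E y} = IN_wedge E y"
      by (auto simp: IN_wedge_def)
    have "(\<Sum>x\<in>?S. ?l x * ?K x y) = (\<Sum>x\<in>wedges E. ?l x * ?K x y)"
      by (rule to_wedges)
    also have "\<dots> = (\<Sum>x\<in>wedges E. if x \<in> IN_wedge E y
        then ?l x * wedge_prob E \<alpha> \<beta> \<gamma> y else 0)"
      by (rule sum.cong) (auto simp: wedge_kernel_def)
    also have "\<dots> = (\<Sum>x\<in>IN_wedge E y. ?l x) * wedge_prob E \<alpha> \<beta> \<gamma> y"
      using fin by (simp add: IN sum_distrib_right flip: sum.inter_filter)
    also have "\<dots> = (\<Sum>x\<in>ON_wedge E y. ?l x) * wedge_prob E \<alpha> \<beta> \<gamma> y"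
      using eul y by (simp add: weighted_eulerian_def)
    also have "\<dots> = ?l y"
      using ON_pos y by (fastforce simp: wedge_prob_def)
    finally have "(\<Sum>x\<in>?S. ?l x * ?K x y) / Z = ?l y / Z"
      by simp
    then show ?thesis
      by (simp add: sum_divide_distrib)
  qed
  have "stationary_distribution ?S ?K (\<lambda>w. ?l w / Z)"
    unfolding stationary_distribution_def
  proof (intro conjI ballI)
    show "?l x / Z \<ge> 0" for x
      using \<open>Z > 0\<close> wedge_type_nonneg[OF par, of E] by simp
    show "(\<Sum>x\<in>?S. ?l x / Z) = 1"
      using Z_states \<open>Z > 0\<close> by (simp flip: sum_divide_distrib)
    show "(\<Sum>x\<in>?S. ?l x / Z * ?K x y) = ?l y / Z" if "y \<in> ?S" for y
      using inv that wedge_states_subset by blast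
  qed
  then show ?thesis
    unfolding wedge_stationary_def Z_def using wedge_type_nonstate by fastforce
qed

lemma wedge_stationary_cong:
  assumes eq: "\<forall>w\<in>wedges E. \<mu> w = \<nu> w"
  shows "wedge_stationary E \<alpha> \<beta> \<gamma> \<mu> \<longleftrightarrow> wedge_stationary E \<alpha> \<beta> \<gamma> \<nu>"
proof -
  have "\<forall>w\<in>wedge_states E \<alpha>. \<mu> w = \<nu> w"
    using eq wedge_states_subset by blast
  then have "stationary_distribution (wedge_states E \<alpha>) K \<mu>
      \<longleftrightarrow> stationary_distribution (wedge_states E \<alpha>) K \<nu>" for K
    by (simp add: stationary_distribution_def)
  then show ?thesis
    using eq by (simp add: wedge_stationary_def)
qed

lemma wedge_stationary_iff:
  assumes fin: "finite (wedges E)" and par: "\<alpha> \<ge> 0" "\<beta> > 0" "\<gamma> > 0"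
    and irr: "irreducible_kernel (wedge_states E \<alpha>) (wedge_kernel E \<alpha> \<beta> \<gamma>)"
    and \<nu>: "wedge_stationary E \<alpha> \<beta> \<gamma> \<nu>"
  shows "wedge_stationary E \<alpha> \<beta> \<gamma> \<mu> \<longleftrightarrow> (\<forall>w\<in>wedges E. \<mu> w = \<nu> w)"
proof
  assume \<mu>: "wedge_stationary E \<alpha> \<beta> \<gamma> \<mu>"
  show "\<forall>w\<in>wedges E. \<mu> w = \<nu> w"
  proof
    fix w assume w: "w \<in> wedges E"
    show "\<mu> w = \<nu> w"
    proof (cases "w \<in> wedge_states E \<alpha>")
      case True
      have "finite (wedge_states E \<alpha>)"
        using finite_subset[OF wedge_states_subset fin] .
      moreover have "\<forall>x\<in>wedge_states E \<alpha>. \<forall>y\<in>wedge_states E \<alpha>. wedge_kernel E \<alpha> \<beta> \<gamma> x y \<ge> 0"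
        using wedge_kernel_nonneg[OF par] by blast
      ultimately show ?thesis
        using stationary_distribution_unique[OF _ _ irr _ _ True] \<mu> \<nu>
        unfolding wedge_stationary_def by blast
    next
      case False
      then show ?thesis
        using \<mu> \<nu> w by (simp add: wedge_stationary_def)
    qed
  qed
next
  assume "\<forall>w\<in>wedges E. \<mu> w = \<nu> w"
  then show "wedge_stationary E \<alpha> \<beta> \<gamma> \<mu>"
    using \<nu> wedge_stationary_cong by blast
qed

section \<open>Wedge directed detailed balance\<close>

lemma detailed_balance_type:
  assumes eul: "weighted_eulerian E \<alpha> \<beta> \<gamma>"
    and \<mu>: "\<forall>w\<in>wedges E. \<mu> w = wedge_type E \<alpha> \<beta> \<gamma> w / Z"
  shows "wedge_directed_detailed_balance E \<alpha> \<beta> \<gamma> \<mu>"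
  unfolding wedge_directed_detailed_balance_def
proof (intro ballI)
  fix w w' assume w: "w \<in> wedges E" and w': "w' \<in> wedges E"
  let ?l = "wedge_type E \<alpha> \<beta> \<gamma>" and ?K = "wedge_kernel E \<alpha> \<beta> \<gamma>"
  have rev: "wedge_rev x \<in> wedges E" if "x \<in> wedges E" for x
    using that by (auto simp: wedges_def dir_edges_def wedge_rev_def w1_def w2_def w3_def
        insert_commute)
  have IN: "w \<in> IN_wedge E w' \<longleftrightarrow> w2 w = w1 w' \<and> w3 w = w2 w'"
    using w by (simp add: IN_wedge_def)
  have IN_rev: "wedge_rev w' \<in> IN_wedge E (wedge_rev w) \<longleftrightarrow> w \<in> IN_wedge E w'"
    unfolding IN using rev[OF w'] by (auto simp: IN_wedge_def wedge_rev_coord)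
  show "\<mu> w * ?K w w' = \<mu> w' * ?K (wedge_rev w') (wedge_rev w)"
  proof (cases "w \<in> IN_wedge E w'")
    case True
    let ?ow = "out_weight E \<alpha> \<beta> \<gamma>"
    have "?K w w' = ?l w' / ?ow (w1 w') (w2 w')"
      using True w' by (simp add: wedge_kernel_def wedge_prob_def sum_ON_wedge)
    moreover have "?K (wedge_rev w') (wedge_rev w) = ?l w / ?ow (w2 w') (w1 w')"
      using True IN IN_rev sum_ON_wedge[OF rev[OF w]]
      by (simp add: wedge_kernel_def wedge_prob_def wedge_type_rev wedge_rev_coord)
    moreover have "?ow (w1 w') (w2 w') = ?ow (w2 w') (w1 w')"
      using eul wedge_edge[OF w'] unfolding weighted_eulerian_iff_out_weight_sym by blast
    ultimately show ?thesis
      using \<mu> w w' by simp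
  next
    case False
    then show ?thesis
      using IN_rev by (simp add: wedge_kernel_def)
  qed
qed

section \<open>Stationary distributions of the walk and of its wedge chain\<close>

theorem theorem3p6:
  fixes V :: "'a set" and E :: "'a set set" and \<alpha> \<beta> \<gamma> :: real
  assumes "finite V" and "simple_graph V E" and "connected_graph V E"
    and "\<alpha> \<ge> 0" and "\<beta> > 0" and "\<gamma> > 0"
  shows "(weighted_eulerian E \<alpha> \<beta> \<gamma> \<longleftrightarrow> regular_graph V E) \<and>
    ((\<forall>w\<in>wedges E. (\<Sum>w'\<in>ON_wedge E w. wedge_type E \<alpha> \<beta> \<gamma> w') > 0) \<longrightarrow>
     irreducible_kernel (wedge_states E \<alpha>) (wedge_kernel E \<alpha> \<beta> \<gamma>) \<longrightarrow>
     weighted_eulerian E \<alpha> \<beta> \<gamma> \<longrightarrow>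
     (let Z = (\<Sum>w'\<in>wedges E. wedge_type E \<alpha> \<beta> \<gamma> w') in
       (\<forall>\<mu>. wedge_stationary E \<alpha> \<beta> \<gamma> \<mu> \<longleftrightarrow>
              (\<forall>w\<in>wedges E. \<mu> w = wedge_type E \<alpha> \<beta> \<gamma> w / Z)) \<and>
       (\<forall>\<pi>. node2vec_stationary V E \<alpha> \<beta> \<gamma> \<pi> \<longleftrightarrow>
              (\<forall>v\<in>V. \<pi> v = (\<Sum>w\<in>IN_vertex E v. wedge_type E \<alpha> \<beta> \<gamma> w / Z))) \<and>
       (\<forall>\<mu>. wedge_stationary E \<alpha> \<beta> \<gamma> \<mu> \<longrightarrow>
              wedge_directed_detailed_balance E \<alpha> \<beta> \<gamma> \<mu>)))"
proof (intro conjI impI)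
  show "weighted_eulerian E \<alpha> \<beta> \<gamma> \<longleftrightarrow> regular_graph V E"
    using weighted_eulerian_iff_regular assms(1-3) \<open>\<gamma> > 0\<close> .
next
  let ?l = "wedge_type E \<alpha> \<beta> \<gamma>"
  define Z where "Z = (\<Sum>w'\<in>wedges E. ?l w')"
  assume ON_pos: "\<forall>w\<in>wedges E. (\<Sum>w'\<in>ON_wedge E w. ?l w') > 0"
    and irr: "irreducible_kernel (wedge_states E \<alpha>) (wedge_kernel E \<alpha> \<beta> \<gamma>)"
    and eul: "weighted_eulerian E \<alpha> \<beta> \<gamma>"
  have fin: "finite (wedges E)"
    using finite_wedges assms(1,2) .
  have "wedge_states E \<alpha> \<noteq> {}"
    using irr by (simp add: irreducible_kernel_def)
  then have st: "wedge_stationary E \<alpha> \<beta> \<gamma> (\<lambda>w. ?l w / Z)"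
    using wedge_stationary_type[OF fin assms(4-6) ON_pos _ eul] by (simp add: Z_def)
  have iff: "wedge_stationary E \<alpha> \<beta> \<gamma> \<mu> \<longleftrightarrow> (\<forall>w\<in>wedges E. \<mu> w = ?l w / Z)" for \<mu>
    using wedge_stationary_iff[OF fin assms(4-6) irr st] .
  have proj: "node2vec_stationary V E \<alpha> \<beta> \<gamma> \<pi>
      \<longleftrightarrow> (\<forall>v\<in>V. \<pi> v = (\<Sum>w\<in>IN_vertex E v. ?l w / Z))" for \<pi>
  proof -
    have "(\<Sum>w\<in>IN_vertex E v. \<mu> w) = (\<Sum>w\<in>IN_vertex E v. ?l w / Z)"
      if "wedge_stationary E \<alpha> \<beta> \<gamma> \<mu>" for \<mu> v
      using that iff by (intro sum.cong) (auto simp: IN_vertex_def)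
    then show ?thesis
      unfolding node2vec_stationary_def using st by (metis (mono_tags, lifting))
  qed
  have "wedge_stationary E \<alpha> \<beta> \<gamma> \<mu> \<longrightarrow> wedge_directed_detailed_balance E \<alpha> \<beta> \<gamma> \<mu>" for \<mu>
    using iff detailed_balance_type[OF eul] by blast
  then show "let Z = (\<Sum>w'\<in>wedges E. ?l w') in
      (\<forall>\<mu>. wedge_stationary E \<alpha> \<beta> \<gamma> \<mu> \<longleftrightarrow> (\<forall>w\<in>wedges E. \<mu> w = ?l w / Z)) \<and>
      (\<forall>\<pi>. node2vec_stationary V E \<alpha> \<beta> \<gamma> \<pi> \<longleftrightarrow>
        (\<forall>v\<in>V. \<pi> v = (\<Sum>w\<in>IN_vertex E v. ?l w / Z))) \<and>
      (\<forall>\<mu>. wedge_stationary E \<alpha> \<beta> \<gamma> \<mu> \<longrightarrow> wedge_directed_detailed_balance E \<alpha> \<beta> \<gamma> \<mu>)"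
    unfolding Let_def Z_def[symmetric] using iff proj by blast
qed

end
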